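(* Let $M_1,M_2,M_3\in SL_2(\mathbb C)$ be the monodromy matrices of the $2\times2$ Fuchsian system with four simple poles associated with the sixth Painlevé equation, and let $\{\cdot,\cdot\}$ be the Korotkin–Samtleben bracket on their matrix entries (defined in the context). Restricted to the adjoint-invariant functions $$G_{i,j}:=-\mathrm{Tr}(M_iM_j),\qquad 1\le i<j\le3,$$ the Korotkin–Samtleben bracket is given by $$\{G_{1,2},G_{2,3}\}=G_{1,2}G_{2,3}-2G_{1,3}-\omega_{1,3},$$ $$\{G_{2,3},G_{1,3}\}=G_{2,3}G_{1,3}-2G_{1,2}-\omega_{1,2},$$ $$\{G_{1,3},G_{1,2}\}=G_{1,2}G_{1,3}-2G_{2,3}-\omega_{2,3},$$ where $\omega_{i,j}=G_iG_j+G_kG_\infty$ for $\{i,j,k\}=\{1,2,3\}$, $G_i=-\mathrm{Tr}(M_i)$ and $G_\infty=-\mathrm{Tr}(M_1M_2M_3)$.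
   Context: Notation: for a $2\times2$ matrix $M$, write $\overset{1}{M}=M\otimes\mathbb 1$ and $\overset{2}{M}=\mathbb 1\otimes M$; $\Omega=\sum_{i,j}E_{ij}\otimes E_{ji}$ is the exchange (permutation) matrix on $\mathbb C^2\otimes\mathbb C^2$; $\{M\overset{\otimes}{,}N\}$ is the $4\times4$ matrix of brackets of entries, $\{M\overset{\otimes}{,}N\}=\sum_{a,b,c,d}\{M_{ab},N_{cd}\}\,E_{ab}\otimes E_{cd}$. The Korotkin–Samtleben bracket is the antisymmetric bilinear operation, a derivation in each argument, on functions of the entries of $(M_1,M_2,M_3)$ determined by $$\{M_i\overset{\otimes}{,}M_i\}=\tfrac12\left(\overset{2}{M_i}\,\Omega\,\overset{1}{M_i}-\overset{1}{M_i}\,\Omega\,\overset{2}{M_i}\right),$$ $$\{M_i\overset{\otimes}{,}M_j\}=\tfrac12\left(\overset{1}{M_i}\,\Omega\,\overset{2}{M_j}+\overset{2}{M_j}\,\Omega\,\overset{1}{M_i}-\Omega\,\overset{1}{M_i}\overset{2}{M_j}-\overset{2}{M_j}\overset{1}{M_i}\,\Omega\right)\quad\text{for } i<j,$$ with $i>j$ obtained by antisymmetry. It does not satisfy the Jacobi identity on all functions, but it restricts to a Poisson bracket on functions invariant under simultaneous conjugation of $(M_1,M_2,M_3)$. It is known to be the image, under the Riemann–Hilbert correspondence, of the standard Lie–Poisson bracket on $\oplus_1^3\mathfrak{sl}^*(2,\mathbb C)$. The monodromy matrices, with respect to a basis of loops around the three finite poles, satisfy $\det M_i=1$ and $M_1M_2M_3M_\infty=\mathbb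 1$. *)

theory Defs
  imports "HOL-Complex_Analysis.Winding_Numbers"
begin

section \<open>The Korotkin-Samtleben bracket\<close>

text \<open>
  A triple of \<open>2 \<times> 2\<close> matrices is a vector \<open>M\<close> indexed by the three-element type \<open>3\<close>, with
  components \<open>M $ 1\<close>, \<open>M $ 2\<close>, \<open>M $ 3\<close>.  In that type \<open>3 = 0\<close>, so its library ordering does not
  satisfy \<open>1 < 2 < 3\<close>; the condition \<open>i < j\<close> is therefore spelled out as
  \<open>(i, j) \<in> {(1, 2), (1, 3), (2, 3)}\<close>.
\<close>

type_synonym mat2 = "complex^2^2"
type_synonym mat4 = "complex^(2 \<times> 2)^(2 \<times> 2)"
type_synonym triple = "mat2^3"

definition kron :: "mat2 \<Rightarrow> mat2 \<Rightarrow> mat4" where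
  "kron A B = (\<chi> p q. A $ fst p $ fst q * B $ snd p $ snd q)"

definition slot1 :: "mat2 \<Rightarrow> mat4" where
  "slot1 A = kron A (mat 1)"

definition slot2 :: "mat2 \<Rightarrow> mat4" where
  "slot2 A = kron (mat 1) A"

definition mat_unit :: "2 \<Rightarrow> 2 \<Rightarrow> mat2" where
  "mat_unit a b = axis a (axis b 1)"

definition Omega :: mat4 where
  "Omega = (\<Sum>i\<in>UNIV. \<Sum>j\<in>UNIV. kron (mat_unit i j) (mat_unit j i))"

definition entry :: "3 \<Rightarrow> 2 \<Rightarrow> 2 \<Rightarrow> triple \<Rightarrow> complex" where
  "entry i a b = (\<lambda>M. M $ i $ a $ b)"

inductive_set polyfun :: "(triple \<Rightarrow> complex) set" where
  const: "(\<lambda>M. c) \<in> polyfun"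
| entry: "entry i a b \<in> polyfun"
| add: "f \<in> polyfun \<Longrightarrow> g \<in> polyfun \<Longrightarrow> (\<lambda>M. f M + g M) \<in> polyfun"
| mult: "f \<in> polyfun \<Longrightarrow> g \<in> polyfun \<Longrightarrow> (\<lambda>M. f M * g M) \<in> polyfun"

type_synonym bracket =
  "(triple \<Rightarrow> complex) \<Rightarrow> (triple \<Rightarrow> complex) \<Rightarrow> (triple \<Rightarrow> complex)"

definition bracket_matrix :: "bracket \<Rightarrow> 3 \<Rightarrow> 3 \<Rightarrow> triple \<Rightarrow> mat4" where
  "bracket_matrix br i j M =
     (\<Sum>a\<in>UNIV. \<Sum>b\<in>UNIV. \<Sum>c\<in>UNIV. \<Sum>d\<in>UNIV.
        map_matrix ((*) (br (entry i a b) (entry j c d) M)) (kron (mat_unit a b) (mat_unit c d)))"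

definition KS_diag :: "mat2 \<Rightarrow> mat4" where
  "KS_diag A = (1/2) *\<^sub>R (slot2 A ** Omega ** slot1 A - slot1 A ** Omega ** slot2 A)"

definition KS_offdiag :: "mat2 \<Rightarrow> mat2 \<Rightarrow> mat4" where
  "KS_offdiag A B = (1/2) *\<^sub>R
     (slot1 A ** Omega ** slot2 B + slot2 B ** Omega ** slot1 A
       - Omega ** slot1 A ** slot2 B - slot2 B ** slot1 A ** Omega)"

text \<open>
  The functions of the matrix entries are the polynomial ones; nothing is required of \<open>br\<close> on
  other functions, so a bracket on a larger algebra of functions is covered as well.
  Existence and uniqueness (on \<open>polyfun\<close>) are \<open>KS_bracket_exists\<close> and \<open>KS_bracket_unique\<close> below.
\<close>

definition KS_bracket :: "bracket \<Rightarrow> bool" where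
  "KS_bracket br \<longleftrightarrow>
     (\<forall>f\<in>polyfun. \<forall>g\<in>polyfun. \<forall>M. br f g M = - br g f M) \<and>
     (\<forall>f\<in>polyfun. \<forall>g\<in>polyfun. \<forall>h\<in>polyfun. \<forall>M.
        br (\<lambda>N. f N + g N) h M = br f h M + br g h M \<and>
        br h (\<lambda>N. f N + g N) M = br h f M + br h g M) \<and>
     (\<forall>c. \<forall>f\<in>polyfun. \<forall>h\<in>polyfun. \<forall>M.
        br (\<lambda>N. c * f N) h M = c * br f h M \<and>
        br h (\<lambda>N. c * f N) M = c * br h f M) \<and>
     (\<forall>f\<in>polyfun. \<forall>g\<in>polyfun. \<forall>h\<in>polyfun. \<forall>M.
        br (\<lambda>N. f N * g N) h M = br f h M * g M + f M * br g h M \<and>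
        br h (\<lambda>N. f N * g N) M = br h f M * g M + f M * br h g M) \<and>
     (\<forall>i M. bracket_matrix br i i M = KS_diag (M $ i)) \<and>
     (\<forall>(i, j) \<in> {(1, 2), (1, 3), (2, 3)}. \<forall>M.
        bracket_matrix br i j M = KS_offdiag (M $ i) (M $ j))"

subsection \<open>Well-definedness of the bracket\<close>

lemma bracket_matrix_nth:
  "bracket_matrix br i j M $ (a, c) $ (b, d) = br (entry i a b) (entry j c d) M"
proof -
  have "bracket_matrix br i j M $ (a, c) $ (b, d) =
    (\<Sum>a'\<in>UNIV. \<Sum>b'\<in>UNIV. \<Sum>c'\<in>UNIV. \<Sum>d'\<in>UNIV.
        br (entry i a' b') (entry j c' d') M *
        ((if a = a' \<and> b = b' then 1 else 0) * (if c = c' \<and> d = d' then 1 else 0)))"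
    unfolding bracket_matrix_def
    by (simp add: kron_def mat_unit_def axis_def) (intro sum.cong refl, auto)
  also have "\<dots> = br (entry i a b) (entry j c d) M"
    using exhaust_2[of a] exhaust_2[of b] exhaust_2[of c] exhaust_2[of d]
    by (auto simp: sum_2)
  finally show ?thesis .
qed

lemma KS_bracketD:
  assumes "KS_bracket br"
  shows KS_anti: "f \<in> polyfun \<Longrightarrow> g \<in> polyfun \<Longrightarrow> br f g M = - br g f M"
    and KS_add: "f \<in> polyfun \<Longrightarrow> g \<in> polyfun \<Longrightarrow> h \<in> polyfun \<Longrightarrow>
      br (\<lambda>N. f N + g N) h M = br f h M + br g h M"
    and KS_cmult: "f \<in> polyfun \<Longrightarrow> h \<in> polyfun \<Longrightarrow> br (\<lambda>N. c * f N) h M = c * br f h M"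
    and KS_mult: "f \<in> polyfun \<Longrightarrow> g \<in> polyfun \<Longrightarrow> h \<in> polyfun \<Longrightarrow>
      br (\<lambda>N. f N * g N) h M = br f h M * g M + f M * br g h M"
    and KS_matrix_diag: "bracket_matrix br i i M = KS_diag (M $ i)"
    and KS_matrix_off: "(i, j) \<in> {(1, 2), (1, 3), (2, 3)} \<Longrightarrow>
      bracket_matrix br i j M = KS_offdiag (M $ i) (M $ j)"
  using assms unfolding KS_bracket_def by (blast, blast, blast, blast, blast, fast)

lemma KS_const:
  assumes "KS_bracket br" "g \<in> polyfun"
  shows "br (\<lambda>N. c) g M = 0"
proof -
  have one: "(\<lambda>N::triple. 1::complex) \<in> polyfun"
    by (rule polyfun.const)
  have "br (\<lambda>N. 1) g M = 0"
    using KS_mult[OF assms(1) one one assms(2), of M] by simp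
  then show ?thesis
    using KS_cmult[OF assms(1) one assms(2), of c M] by simp
qed

theorem KS_bracket_unique:
  assumes br: "KS_bracket br" and br': "KS_bracket br'"
    and f: "f \<in> polyfun" and g: "g \<in> polyfun"
  shows "br f g M = br' f g M"
proof -
  have off: "br (entry i a b) (entry j c d) M = br' (entry i a b) (entry j c d) M"
    if "i = j \<or> (i, j) \<in> {(1, 2), (1, 3), (2, 3)}" for i j a b c d
  proof -
    have "bracket_matrix br i j M = bracket_matrix br' i j M"
      using that KS_matrix_diag[OF br] KS_matrix_diag[OF br'] KS_matrix_off[OF br]
        KS_matrix_off[OF br'] by metis
    then show ?thesis by (metis bracket_matrix_nth)
  qed
  have ent: "br (entry i a b) (entry j c d) M = br' (entry i a b) (entry j c d) M" for i j a b c d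
  proof -
    consider "i = j \<or> (i, j) \<in> {(1, 2), (1, 3), (2, 3)}" | "(j, i) \<in> {(1, 2), (1, 3), (2, 3)}"
      using exhaust_3[of i] exhaust_3[of j] by auto
    then show ?thesis
    proof cases
      case 1
      then show ?thesis by (rule off)
    next
      case 2
      then have "br (entry j c d) (entry i a b) M = br' (entry j c d) (entry i a b) M"
        by (intro off) blast
      then show ?thesis
        using KS_anti[OF br polyfun.entry polyfun.entry, of i a b j c d M]
          KS_anti[OF br' polyfun.entry polyfun.entry, of i a b j c d M] by simp
    qed
  qed
  have step: "br f g M = br' f g M"
    if f: "f \<in> polyfun" and g: "g \<in> polyfun"
      and base: "\<And>i a b. br (entry i a b) g M = br' (entry i a b) g M" for f g
    using f
  proof (induction f)
    case (const c)
    show ?case using KS_const[OF br g] KS_const[OF br' g] by simp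
  next
    case (entry i a b)
    show ?case by (rule base)
  next
    case (add f1 f2)
    then show ?case using KS_add[OF br _ _ g] KS_add[OF br' _ _ g] by simp
  next
    case (mult f1 f2)
    then show ?case using KS_mult[OF br _ _ g] KS_mult[OF br' _ _ g] by simp
  qed
  have "br (entry i a b) g M = br' (entry i a b) g M" for i a b
    using step[OF g polyfun.entry ent, of i a b] KS_anti[OF br polyfun.entry g, of i a b M]
      KS_anti[OF br' polyfun.entry g, of i a b M] by simp
  then show ?thesis by (rule step[OF f g])
qed

definition coord :: "3 \<times> 2 \<times> 2 \<Rightarrow> triple \<Rightarrow> complex" where
  "coord x M = M $ fst x $ fst (snd x) $ snd (snd x)"

definition upd :: "3 \<times> 2 \<times> 2 \<Rightarrow> triple \<Rightarrow> complex \<Rightarrow> triple" where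
  "upd x M z = (\<chi> i a b. if (i, a, b) = x then z else M $ i $ a $ b)"

definition pd :: "3 \<times> 2 \<times> 2 \<Rightarrow> (triple \<Rightarrow> complex) \<Rightarrow> triple \<Rightarrow> complex" where
  "pd x f M = deriv (\<lambda>z. f (upd x M z)) (coord x M)"

definition KS_tensor :: "3 \<Rightarrow> 3 \<Rightarrow> triple \<Rightarrow> mat4" where
  "KS_tensor i j M =
     (if i = j then KS_diag (M $ i) else KS_offdiag (M $ i) (M $ j))"

definition KS_coeff :: "3 \<times> 2 \<times> 2 \<Rightarrow> 3 \<times> 2 \<times> 2 \<Rightarrow> triple \<Rightarrow> complex" where
  "KS_coeff = (\<lambda>(i, a, b) (j, c, d) M.
     if (j, i) \<in> {(1, 2), (1, 3), (2, 3)} then - KS_tensor j i M $ (c, a) $ (d, b)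
     else KS_tensor i j M $ (a, c) $ (b, d))"

definition KS_explicit :: bracket where
  "KS_explicit f g M = (\<Sum>x\<in>UNIV. \<Sum>y\<in>UNIV. pd x f M * pd y g M * KS_coeff x y M)"

lemma upd_coord [simp]: "upd x M (coord x M) = M"
  by (auto simp: upd_def coord_def vec_eq_iff)

lemma entry_upd: "entry i a b (upd x M z) = (if (i, a, b) = x then z else entry i a b M)"
  by (simp add: entry_def upd_def)

lemma polyfun_diff:
  "f \<in> polyfun \<Longrightarrow> (\<lambda>z. f (upd x M z)) field_differentiable at w"
proof (induction rule: polyfun.induct)
  case (entry i a b)
  then show ?case by (cases "(i, a, b) = x") (simp_all add: entry_upd)
qed (auto intro: field_differentiable_add field_differentiable_mult)

lemma pd_const: "pd x (\<lambda>N. c) M = 0"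
  by (simp add: pd_def)

lemma pd_entry: "pd x (entry i a b) M = (if x = (i, a, b) then 1 else 0)"
  by (auto simp: pd_def entry_upd)

lemma pd_add:
  "f \<in> polyfun \<Longrightarrow> g \<in> polyfun \<Longrightarrow> pd x (\<lambda>N. f N + g N) M = pd x f M + pd x g M"
  by (simp add: pd_def polyfun_diff)

lemma pd_mult:
  "f \<in> polyfun \<Longrightarrow> g \<in> polyfun \<Longrightarrow> pd x (\<lambda>N. f N * g N) M = pd x f M * g M + f M * pd x g M"
  by (simp add: pd_def polyfun_diff)

lemma pd_cmult:
  "f \<in> polyfun \<Longrightarrow> pd x (\<lambda>N. c * f N) M = c * pd x f M"
  using pd_mult[OF polyfun.const, of f x c M] by (simp add: pd_const)

lemma sum_UNIV_22: "sum f (UNIV :: (2 \<times> 2) set) = f (1,1) + f (1,2) + f (2,1) + f (2,2)"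
  for f :: "2 \<times> 2 \<Rightarrow> complex"
proof -
  have "sum f (UNIV :: (2 \<times> 2) set) = (\<Sum>i\<in>UNIV. \<Sum>j\<in>UNIV. f (i, j))"
    by (simp add: sum.cartesian_product)
  then show ?thesis by (simp add: sum_2 add.assoc)
qed

lemma kron_mat_unit_nth:
  "kron (mat_unit i j) (mat_unit k l) $ (a, c) $ (b, d) =
    (if a = i \<and> b = j \<and> c = k \<and> d = l then 1 else 0)"
  by (simp add: kron_def mat_unit_def axis_def)

lemma Omega_nth: "Omega $ (a, c) $ (b, d) = (if a = d \<and> c = b then 1 else 0)"
  unfolding Omega_def sum_component kron_mat_unit_nth
  using exhaust_2[of a] exhaust_2[of b] exhaust_2[of c] exhaust_2[of d]
  by (elim disjE) (simp_all add: sum_2)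

lemma mat4_mult_nth:
  "((X :: mat4) ** Y) $ p $ q = X $ p $ (1,1) * Y $ (1,1) $ q + X $ p $ (1,2) * Y $ (1,2) $ q
    + X $ p $ (2,1) * Y $ (2,1) $ q + X $ p $ (2,2) * Y $ (2,2) $ q"
  by (simp add: matrix_matrix_mult_def sum_UNIV_22)

lemma slot1_nth: "slot1 A $ (a, c) $ (b, d) = (if c = d then A $ a $ b else 0)"
  by (simp add: slot1_def kron_def mat_def)

lemma slot2_nth: "slot2 A $ (a, c) $ (b, d) = (if a = b then A $ c $ d else 0)"
  by (simp add: slot2_def kron_def mat_def)

lemma slot2_Omega_slot1:
  "(slot2 A ** Omega ** slot1 A) $ (a, c) $ (b, d) = (if a = d then (A ** A) $ c $ b else 0)"
proof -
  have 1: "(slot2 A ** Omega) $ (a, c) $ (r, s) = (if a = s then A $ c $ r else 0)" for r s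
    unfolding mat4_mult_nth Omega_nth slot2_nth
    using exhaust_2[of a] exhaust_2[of c] exhaust_2[of r] exhaust_2[of s] by (elim disjE) simp_all
  show ?thesis
    unfolding mat4_mult_nth[of "slot2 A ** Omega"] 1 slot1_nth
    using exhaust_2[of a] exhaust_2[of b] exhaust_2[of c] exhaust_2[of d]
    by (elim disjE) (simp_all add: matrix_matrix_mult_def[of A] sum_2)
qed

lemma slot1_Omega_slot2:
  "(slot1 A ** Omega ** slot2 A) $ (a, c) $ (b, d) = (if c = b then (A ** A) $ a $ d else 0)"
proof -
  have 1: "(slot1 A ** Omega) $ (a, c) $ (r, s) = (if c = r then A $ a $ s else 0)" for r s
    unfolding mat4_mult_nth Omega_nth slot1_nth
    using exhaust_2[of a] exhaust_2[of c] exhaust_2[of r] exhaust_2[of s] by (elim disjE) simp_all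
  show ?thesis
    unfolding mat4_mult_nth[of "slot1 A ** Omega"] 1 slot2_nth
    using exhaust_2[of a] exhaust_2[of b] exhaust_2[of c] exhaust_2[of d]
    by (elim disjE) (simp_all add: matrix_matrix_mult_def[of A] sum_2)
qed

lemma KS_diag_anti: "KS_diag A $ (c, a) $ (d, b) = - KS_diag A $ (a, c) $ (b, d)"
  by (auto simp: KS_diag_def slot2_Omega_slot1 slot1_Omega_slot2 scaleR_diff_right)

lemma KS_coeff_anti: "KS_coeff x y M = - KS_coeff y x M"
proof -
  obtain i a b j c d where xy: "x = (i, a, b)" "y = (j, c, d)" by (metis surj_pair)
  show ?thesis
    using exhaust_3[of i] exhaust_3[of j] KS_diag_anti[of "M $ i" c a d b]
    by (auto simp: xy KS_coeff_def KS_tensor_def)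
qed

lemma KS_explicit_entry: "KS_explicit (entry i a b) (entry j c d) M = KS_coeff (i, a, b) (j, c, d) M"
proof -
  have 1: "(if P then 1 else 0) * (if Q then 1 else 0) * t = (if P then if Q then t else 0 else 0)"
    for P Q and t :: complex
    by simp
  have 2: "(\<Sum>y\<in>UNIV. if P then h y else 0) = (if P then sum h UNIV else 0)"
    for P and h :: "3 \<times> 2 \<times> 2 \<Rightarrow> complex"
    by simp
  show ?thesis
    unfolding KS_explicit_def pd_entry 1 2 by simp
qed

theorem KS_bracket_exists: "KS_bracket KS_explicit"
proof -
  have anti: "KS_explicit f g M = - KS_explicit g f M" for f g M
  proof -
    have "KS_explicit f g M = (\<Sum>y\<in>UNIV. \<Sum>x\<in>UNIV. pd x f M * pd y g M * KS_coeff x y M)"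
      unfolding KS_explicit_def by (rule sum.swap)
    also have "\<dots> = (\<Sum>y\<in>UNIV. \<Sum>x\<in>UNIV. - (pd y g M * pd x f M * KS_coeff y x M))"
      by (intro sum.cong refl) (subst KS_coeff_anti, simp)
    finally show ?thesis by (simp add: KS_explicit_def sum_negf)
  qed
  have add: "KS_explicit (\<lambda>N. f N + g N) h M = KS_explicit f h M + KS_explicit g h M"
    if "f \<in> polyfun" "g \<in> polyfun" for f g h M
    using that by (simp add: KS_explicit_def pd_add algebra_simps sum.distrib)
  have cmult: "KS_explicit (\<lambda>N. c * f N) h M = c * KS_explicit f h M"
    if "f \<in> polyfun" for f h c M
    using that by (simp add: KS_explicit_def pd_cmult algebra_simps sum_distrib_left)
  have mult: "KS_explicit (\<lambda>N. f N * g N) h M = KS_explicit f h M * g M + f M * KS_explicit g h M"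
    if "f \<in> polyfun" "g \<in> polyfun" for f g h M
    using that by (simp add: KS_explicit_def pd_mult algebra_simps sum.distrib sum_distrib_left)
  have nth: "bracket_matrix KS_explicit i j M = KS_tensor i j M"
    if "(j, i) \<notin> {(1, 2), (1, 3), (2, 3)}" for i j M
  proof -
    have "bracket_matrix KS_explicit i j M $ p $ q = KS_tensor i j M $ p $ q" for p q
    proof -
      obtain a b c d where pq: "p = (a, c)" "q = (b, d)" by (metis surj_pair)
      show ?thesis
        using that unfolding pq bracket_matrix_nth KS_explicit_entry KS_coeff_def by auto
    qed
    then show ?thesis by (simp add: vec_eq_iff)
  qed
  have diag: "bracket_matrix KS_explicit i i M = KS_diag (M $ i)" for i M
    by (subst nth) (auto simp: KS_tensor_def)
  have off: "bracket_matrix KS_explicit i j M = KS_offdiag (M $ i) (M $ j)"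
    if "(i, j) \<in> {(1, 2), (1, 3), (2, 3)}" for i j M
  proof -
    have "(j, i) \<notin> {(1, 2), (1, 3), (2, 3)}" "i \<noteq> j"
      using that by (elim insertE emptyE; simp)+
    then show ?thesis by (metis nth KS_tensor_def)
  qed
  show ?thesis
    unfolding KS_bracket_def
  proof (intro conjI ballI allI)
    fix f g h M assume p: "f \<in> polyfun" "g \<in> polyfun" "h \<in> polyfun"
    show "KS_explicit (\<lambda>N. f N + g N) h M = KS_explicit f h M + KS_explicit g h M"
      using p add by blast
    show "KS_explicit h (\<lambda>N. f N + g N) M = KS_explicit h f M + KS_explicit h g M"
      using add[OF p(1,2), of h M] anti[of h "\<lambda>N. f N + g N" M] anti[of h f M] anti[of h g M]
      by simp
    show "KS_explicit (\<lambda>N. f N * g N) h M = KS_explicit f h M * g M + f M * KS_explicit g h M"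
      using p mult by blast
    show "KS_explicit h (\<lambda>N. f N * g N) M = KS_explicit h f M * g M + f M * KS_explicit h g M"
      using mult[OF p(1,2), of h M] anti[of h "\<lambda>N. f N * g N" M] anti[of h f M] anti[of h g M]
      by simp
  next
    fix c f h M assume p: "f \<in> polyfun" "h \<in> polyfun"
    show "KS_explicit (\<lambda>N. c * f N) h M = c * KS_explicit f h M"
      using p cmult by blast
    show "KS_explicit h (\<lambda>N. c * f N) M = c * KS_explicit h f M"
      using cmult[OF p(1), of c h M] anti[of h "\<lambda>N. c * f N" M] anti[of h f M] by simp
  next
    fix x :: "3 \<times> 3" assume "x \<in> {(1, 2), (1, 3), (2, 3)}"
    then show "case x of (i, j) \<Rightarrow> \<forall>M. bracket_matrix KS_explicit i j M = KS_offdiag (M $ i) (M $ j)"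
      using off by (cases x) blast
  qed (use anti diag in blast)+
qed

section \<open>The adjoint-invariant functions\<close>

definition G :: "3 \<Rightarrow> triple \<Rightarrow> complex" where
  "G i = (\<lambda>M. - trace (M $ i))"

definition G_inf :: "triple \<Rightarrow> complex" where
  "G_inf = (\<lambda>M. - trace (M $ 1 ** M $ 2 ** M $ 3))"

definition GG :: "3 \<Rightarrow> 3 \<Rightarrow> triple \<Rightarrow> complex" where
  "GG i j = (\<lambda>M. - trace (M $ i ** M $ j))"

text \<open>The index \<open>k\<close> is the one with \<open>{i, j, k} = {1, 2, 3}\<close>.\<close>

definition omega :: "3 \<Rightarrow> 3 \<Rightarrow> triple \<Rightarrow> complex" where
  "omega i j = (\<lambda>M. let k = (THE k. {i, j, k} = {1, 2, 3}) in G i M * G j M + G k M * G_inf M)"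

lemma omega_eq:
  "omega 1 3 M = G 1 M * G 3 M + G 2 M * G_inf M"
  "omega 1 2 M = G 1 M * G 2 M + G 3 M * G_inf M"
  "omega 2 3 M = G 2 M * G 3 M + G 1 M * G_inf M"
proof -
  have k: "{1, 3, k} = {1, 2, 3::3} \<longleftrightarrow> k = 2" "{1, 2, k} = {1, 2, 3::3} \<longleftrightarrow> k = 3"
    "{2, 3, k} = {1, 2, 3::3} \<longleftrightarrow> k = 1" for k :: 3
    using exhaust_3[of k] by (elim disjE; simp add: set_eq_iff forall_3)+
  show "omega 1 3 M = G 1 M * G 3 M + G 2 M * G_inf M"
    "omega 1 2 M = G 1 M * G 2 M + G 3 M * G_inf M"
    "omega 2 3 M = G 2 M * G 3 M + G 1 M * G_inf M"
    unfolding omega_def k by (simp_all add: Let_def)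
qed

section \<open>Monodromy of the Fuchsian system\<close>

text \<open>
  The system \<open>d\<Phi>/dz = (\<Sum>i. A\<^sub>i / (z - u\<^sub>i)) \<Phi>\<close> with traceless residues has four simple poles, at
  the distinct points \<open>u\<^sub>1, u\<^sub>2, u\<^sub>3\<close> and at \<open>\<infinity>\<close>, where the residue is \<open>- (A\<^sub>1 + A\<^sub>2 + A\<^sub>3)\<close>.
\<close>

definition fuchsian_four_poles :: "complex^3 \<Rightarrow> triple \<Rightarrow> bool" where
  "fuchsian_four_poles u A \<longleftrightarrow>
     u $ 1 \<noteq> u $ 2 \<and> u $ 1 \<noteq> u $ 3 \<and> u $ 2 \<noteq> u $ 3 \<and>
     (\<forall>i. trace (A $ i) = 0) \<and> (\<forall>i. A $ i \<noteq> 0) \<and> A $ 1 + A $ 2 + A $ 3 \<noteq> 0"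

definition fuchsian_matrix :: "complex^3 \<Rightarrow> triple \<Rightarrow> complex \<Rightarrow> mat2" where
  "fuchsian_matrix u A z = (\<Sum>i\<in>UNIV. map_matrix (\<lambda>x. x / (z - u $ i)) (A $ i))"

text \<open>All notions below depend only on the germ of \<open>\<Phi>\<close> at the point in question.\<close>

definition fundamental_solution_at ::
    "complex^3 \<Rightarrow> triple \<Rightarrow> (complex \<Rightarrow> mat2) \<Rightarrow> complex \<Rightarrow> bool" where
  "fundamental_solution_at u A \<Phi> p \<longleftrightarrow>
     (\<forall>\<^sub>F z in nhds p. det (\<Phi> z) \<noteq> 0 \<and>
        (\<forall>a b. ((\<lambda>w. \<Phi> w $ a $ b) has_field_derivative
                  (fuchsian_matrix u A z ** \<Phi> z) $ a $ b) (at z)))"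

text \<open>
  \<open>\<Phi> t\<close> is the function element at \<open>\<gamma> t\<close>; function elements at nearby parameters are direct
  continuations of each other.
\<close>

definition continuation_along :: "(real \<Rightarrow> complex) \<Rightarrow> (real \<Rightarrow> complex \<Rightarrow> mat2) \<Rightarrow> bool" where
  "continuation_along \<gamma> \<Phi> \<longleftrightarrow>
     (\<forall>t\<in>{0..1}. (\<forall>a b. (\<lambda>z. \<Phi> t z $ a $ b) analytic_on {\<gamma> t}) \<and>
        (\<exists>\<epsilon>>0. \<forall>s\<in>{0..1}. \<bar>s - t\<bar> < \<epsilon> \<longrightarrow> (\<forall>\<^sub>F z in nhds (\<gamma> s). \<Phi> s z = \<Phi> t z)))"

definition monodromy_along ::
    "(real \<Rightarrow> complex) \<Rightarrow> (complex \<Rightarrow> mat2) \<Rightarrow> mat2 \<Rightarrow> bool" where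
  "monodromy_along \<gamma> \<Phi> M \<longleftrightarrow>
     (\<exists>\<Psi>. continuation_along \<gamma> \<Psi> \<and>
        (\<forall>\<^sub>F z in nhds (pathstart \<gamma>). \<Psi> 0 z = \<Phi> z) \<and>
        (\<forall>\<^sub>F z in nhds (pathfinish \<gamma>). \<Psi> 1 z = \<Phi> z ** M))"

text \<open>
  Simple loops based at \<open>p\<close>, otherwise disjoint, each \<open>\<gamma>\<^sub>i\<close> encircling \<open>u\<^sub>i\<close> alone counterclockwise
  and \<open>\<gamma>inf\<close> encircling all three finite poles clockwise.  Since \<open>\<Phi>\<close> continues along a loop to
  \<open>\<Phi> M\<close>, composition of loops reverses the order of the monodromy matrices, so that the homotopy
  relation corresponds to \<open>M\<^sub>1 M\<^sub>2 M\<^sub>3 M\<^sub>\<infinity> = 1\<close>.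
\<close>

definition loop_basis ::
    "complex^3 \<Rightarrow> complex \<Rightarrow> (3 \<Rightarrow> real \<Rightarrow> complex) \<Rightarrow> (real \<Rightarrow> complex) \<Rightarrow> bool" where
  "loop_basis u p \<gamma> \<gamma>inf \<longleftrightarrow>
     (\<forall>\<delta> \<in> insert \<gamma>inf (range \<gamma>). simple_path \<delta> \<and> pathstart \<delta> = p \<and> pathfinish \<delta> = p \<and>
        path_image \<delta> \<inter> range (($) u) = {}) \<and>
     (\<forall>i j. i \<noteq> j \<longrightarrow> path_image (\<gamma> i) \<inter> path_image (\<gamma> j) = {p}) \<and>
     (\<forall>i. path_image (\<gamma> i) \<inter> path_image \<gamma>inf = {p}) \<and>
     (\<forall>i j. winding_number (\<gamma> i) (u $ j) = (if i = j then 1 else 0)) \<and>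
     (\<forall>j. winding_number \<gamma>inf (u $ j) = - 1) \<and>
     homotopic_paths (- range (($) u)) (\<gamma>inf +++ \<gamma> 3 +++ \<gamma> 2 +++ \<gamma> 1) (linepath p p)"

definition PVI_monodromy :: "triple \<Rightarrow> mat2 \<Rightarrow> bool" where
  "PVI_monodromy M Minf \<longleftrightarrow>
     (\<exists>u A p \<Phi> \<gamma> \<gamma>inf. fuchsian_four_poles u A \<and> fundamental_solution_at u A \<Phi> p \<and>
        loop_basis u p \<gamma> \<gamma>inf \<and>
        (\<forall>i. monodromy_along (\<gamma> i) \<Phi> (M $ i)) \<and> monodromy_along \<gamma>inf \<Phi> Minf)"

end

theory Submission
  imports Defs
begin

text \<open>
  Write \<open>A, B, C\<close> for the three matrices.  Contracting the matrix form of the bracket with constant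
  matrices \<open>X, Y\<close> gives \<open>{tr (A X), tr (B Y)}\<close> as a combination of traces of words in
  \<open>A, B, X, Y\<close>.  By the Leibniz rule \<open>{tr (A B), tr (B C)}\<close> is a sum of four such contractions, in
  which everything cancels except \<open>tr (A B C B) - tr (A B\<^sup>2 C)\<close>; the Cayley-Hamilton identity for
  matrices of determinant one turns this into the quadratic relation.  The other two brackets
  reduce in the same way.
\<close>

lemma trace_2: "trace (A :: mat2) = A $ 1 $ 1 + A $ 2 $ 2"
  by (simp add: trace_def sum_2)

lemma mat2_mult_nth: "((A :: mat2) ** B) $ a $ b = A $ a $ 1 * B $ 1 $ b + A $ a $ 2 * B $ 2 $ b"
  by (simp add: matrix_matrix_mult_def sum_2)

text \<open>Cayley-Hamilton, B^2 = tr(B) B - det(B) 1, multiplied by X and traced.\<close>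

lemma trace_mult_square:
  fixes X B :: mat2
  shows "trace (X ** B ** B) = trace B * trace (X ** B) - det B * trace X"
  by (simp add: trace_2 mat2_mult_nth det_2 algebra_simps)

text \<open>Cayley-Hamilton for B C gives B C B = tr(B C) B - det(B) adj(C), where adj(C) = tr(C) 1
  - C.\<close>

lemma trace_mult_sandwich:
  fixes A B C :: mat2
  shows "trace (A ** B ** C ** B) =
    trace (A ** B) * trace (B ** C) - det B * (trace A * trace C - trace (A ** C))"
  by (simp add: trace_2 mat2_mult_nth det_2 algebra_simps)

lemma trace_rotate:
  fixes A B C D :: mat2
  shows "trace (A ** B ** C ** D) = trace (B ** C ** D ** A)"
    and "trace (A ** B ** C) = trace (B ** C ** A)"
  by (simp_all only: trace_mul_sym[of A] matrix_mul_assoc[symmetric])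

lemma KS_diag_nth:
  "KS_diag A $ (a, c) $ (b, d) =
    1/2 * ((if a = d then (A ** A) $ c $ b else 0) - (if c = b then (A ** A) $ a $ d else 0))"
  by (simp add: KS_diag_def slot2_Omega_slot1 slot1_Omega_slot2)
    (simp add: scaleR_conv_of_real)

text \<open>\<open>Omega\<close> carries a matrix from one slot to the other, so the first two terms
  become products in a single slot times \<open>Omega\<close>; the last two are A \<otimes> B with
  \<open>Omega\<close> on either side.\<close>

lemma KS_offdiag_nth:
  "KS_offdiag A B $ (a, c) $ (b, d) =
    1/2 * ((if c = b then (A ** B) $ a $ d else 0) + (if a = d then (B ** A) $ c $ b else 0)
      - A $ c $ b * B $ a $ d - A $ a $ d * B $ c $ b)"
  using exhaust_2[of a] exhaust_2[of b] exhaust_2[of c] exhaust_2[of d]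
  by (elim disjE; simp add: KS_offdiag_def mat4_mult_nth slot1_nth slot2_nth Omega_nth mat2_mult_nth;
      simp add: scaleR_conv_of_real algebra_simps)

text \<open>This is the trace of R (X \<otimes> Y). For R = \<open>bracket_matrix br i j M\<close>
  it is the bracket of tr(M_i X) and tr(M_j Y) with X, Y held constant.\<close>

definition contraction :: "mat4 \<Rightarrow> mat2 \<Rightarrow> mat2 \<Rightarrow> complex" where
  "contraction R X Y =
     (\<Sum>a\<in>UNIV. \<Sum>b\<in>UNIV. \<Sum>c\<in>UNIV. \<Sum>d\<in>UNIV. R $ (a, c) $ (b, d) * X $ b $ a * Y $ d $ c)"

text \<open>Each term contains one \<open>Omega\<close>, and tr((P \<otimes> Q)
  \<open>Omega\<close>) = tr(P Q) merges the two slots into one word.\<close>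

lemma contraction_KS_diag:
  "contraction (KS_diag A) X Y = 1/2 * (trace (A ** A ** X ** Y) - trace (A ** A ** Y ** X))"
proof -
  define h :: complex where "h = 1/2"  \<comment> \<open>opaque, so that no fractions get cross-multiplied\<close>
  show ?thesis
    unfolding contraction_def KS_diag_nth h_def[symmetric]
    by (simp add: sum_2 trace_2 mat2_mult_nth algebra_simps)
qed

lemma contraction_KS_offdiag:
  "contraction (KS_offdiag A B) X Y =
    1/2 * (trace (A ** B ** Y ** X) + trace (B ** A ** X ** Y)
      - trace (A ** X ** B ** Y) - trace (A ** Y ** B ** X))"
proof -
  define h :: complex where "h = 1/2"
  show ?thesis
    unfolding contraction_def KS_offdiag_nth h_def[symmetric]
    by (simp add: sum_2 trace_2 mat2_mult_nth algebra_simps)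
qed

text \<open>The shape follows the constructors of \<open>polyfun\<close>, so that linearity and the
  Leibniz rule apply by matching.\<close>

lemma GG_eq_sum:
  "GG i j = (\<lambda>M. - 1 * ((entry i 1 1 M * entry j 1 1 M + entry i 1 2 M * entry j 2 1 M)
    + (entry i 2 1 M * entry j 1 2 M + entry i 2 2 M * entry j 2 2 M)))"
  by (simp add: GG_def entry_def trace_2 mat2_mult_nth fun_eq_iff)

lemma GG_polyfun: "GG i j \<in> polyfun"
  unfolding GG_eq_sum by (intro polyfun.intros)

lemma KS_GG_left:
  assumes br: "KS_bracket br" and f: "f \<in> polyfun"
  shows "br (GG i j) f M = - (\<Sum>a\<in>UNIV. \<Sum>b\<in>UNIV.
    br (entry i a b) f M * M $ j $ b $ a + M $ i $ a $ b * br (entry j b a) f M)"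
  unfolding GG_eq_sum
  by (subst KS_cmult[OF br], (intro polyfun.intros f)+,
      simp only: KS_add[OF br] KS_mult[OF br] polyfun.intros f, simp add: sum_2 entry_def)

lemma KS_GG_right:
  assumes br: "KS_bracket br" and f: "f \<in> polyfun"
  shows "br f (GG i j) M = - (\<Sum>a\<in>UNIV. \<Sum>b\<in>UNIV.
    br f (entry i a b) M * M $ j $ b $ a + M $ i $ a $ b * br f (entry j b a) M)"
  unfolding KS_anti[OF br f GG_polyfun] KS_GG_left[OF br f]
  by (simp add: KS_anti[OF br polyfun.entry f] sum_2)

text \<open>The Leibniz rule picks one factor from each trace; the other two are frozen and serve as
  X and Y. The two minus signs cancel.\<close>

lemma KS_GG_GG:
  assumes br: "KS_bracket br"
  shows "br (GG i j) (GG k l) M =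
    contraction (bracket_matrix br i k M) (M $ j) (M $ l)
    + contraction (bracket_matrix br i l M) (M $ j) (M $ k)
    + contraction (bracket_matrix br j k M) (M $ i) (M $ l)
    + contraction (bracket_matrix br j l M) (M $ i) (M $ k)"
  unfolding KS_GG_left[OF br GG_polyfun] KS_GG_right[OF br polyfun.entry]
    contraction_def bracket_matrix_nth
  by (simp add: sum_2 algebra_simps)

text \<open>Supplies the index pairs in reversed order; exchanging the tensor factors also exchanges
  X and Y.\<close>

lemma contraction_bracket_anti:
  assumes br: "KS_bracket br"
  shows "contraction (bracket_matrix br j i M) X Y = - contraction (bracket_matrix br i j M) Y X"
  unfolding contraction_def bracket_matrix_nth
  by (simp add: KS_anti[OF br polyfun.entry polyfun.entry, of j _ _ i] sum_2 algebra_simps)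

text \<open>The subtracted words are rotated so that the repeated matrix stands last, as
  \<open>trace_mult_square\<close> requires.\<close>

lemma KS_GG_words:
  fixes M :: triple
  defines "A \<equiv> M $ 1" and "B \<equiv> M $ 2" and "C \<equiv> M $ 3"
  assumes br: "KS_bracket br"
  shows "br (GG 1 2) (GG 2 3) M = trace (A ** B ** C ** B) - trace (C ** A ** B ** B)"
    and "br (GG 2 3) (GG 1 3) M = trace (B ** C ** A ** C) - trace (A ** B ** C ** C)"
    and "br (GG 1 3) (GG 1 2) M = trace (C ** A ** B ** A) - trace (B ** C ** A ** A)"
proof -
  note diag = KS_matrix_diag[OF br] and off = KS_matrix_off[OF br]
  have contr_diag: "contraction (bracket_matrix br i i M) X Y = contraction (KS_diag (M $ i)) X Y" for i X Y
    by (simp add: diag)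
  have contr_off:
    "contraction (bracket_matrix br 1 2 M) X Y = contraction (KS_offdiag A B) X Y"
    "contraction (bracket_matrix br 1 3 M) X Y = contraction (KS_offdiag A C) X Y"
    "contraction (bracket_matrix br 2 3 M) X Y = contraction (KS_offdiag B C) X Y"
    "contraction (bracket_matrix br 2 1 M) X Y = - contraction (KS_offdiag A B) Y X"
    "contraction (bracket_matrix br 3 1 M) X Y = - contraction (KS_offdiag A C) Y X"
    "contraction (bracket_matrix br 3 2 M) X Y = - contraction (KS_offdiag B C) Y X" for X Y
    using off[of 1 2 M] off[of 1 3 M] off[of 2 3 M]
      contraction_bracket_anti[OF br, of 2 1 M X Y] contraction_bracket_anti[OF br, of 3 1 M X Y]
      contraction_bracket_anti[OF br, of 3 2 M X Y]
    by (simp_all add: A_def B_def C_def)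
  note expand = KS_GG_GG[OF br] contr_diag contr_off contraction_KS_diag contraction_KS_offdiag
    A_def[symmetric] B_def[symmetric] C_def[symmetric]
  \<comment> \<open>Up to rotation only the words ABCB, ABBC and ACBB occur. The contractions for
    (1,2) and (1,3) cancel; those for (2,2) and (2,3) leave the difference.\<close>
  show "br (GG 1 2) (GG 2 3) M = trace (A ** B ** C ** B) - trace (C ** A ** B ** B)"
    unfolding expand
    using trace_rotate(1)[of A B C B] trace_rotate(1)[of B C B A] trace_rotate(1)[of C B A B]
      trace_rotate(1)[of A B B C] trace_rotate(1)[of B B C A] trace_rotate(1)[of B C A B]
      trace_rotate(1)[of A C B B] trace_rotate(1)[of C B B A] trace_rotate(1)[of B B A C]
    by (simp add: field_simps)
  show "br (GG 2 3) (GG 1 3) M = trace (B ** C ** A ** C) - trace (A ** B ** C ** C)"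
    unfolding expand
    using trace_rotate(1)[of B C A C] trace_rotate(1)[of C A C B] trace_rotate(1)[of A C B C]
      trace_rotate(1)[of B C C A] trace_rotate(1)[of C C A B] trace_rotate(1)[of C A B C]
      trace_rotate(1)[of B A C C] trace_rotate(1)[of A C C B] trace_rotate(1)[of C C B A]
    by (simp add: field_simps)
  show "br (GG 1 3) (GG 1 2) M = trace (C ** A ** B ** A) - trace (B ** C ** A ** A)"
    unfolding expand
    using trace_rotate(1)[of C A B A] trace_rotate(1)[of A B A C] trace_rotate(1)[of B A C A]
      trace_rotate(1)[of C A A B] trace_rotate(1)[of A A B C] trace_rotate(1)[of A B C A]
      trace_rotate(1)[of C B A A] trace_rotate(1)[of B A A C] trace_rotate(1)[of A A C B]
    by (simp add: field_simps)
qed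

theorem theorem5p2:
  fixes br :: bracket and M :: triple and Minf :: mat2
  assumes "KS_bracket br"
    and "PVI_monodromy M Minf"
    and "\<forall>i. det (M $ i) = 1"
    and "M $ 1 ** M $ 2 ** M $ 3 ** Minf = mat 1"
  shows "br (GG 1 2) (GG 2 3) M = GG 1 2 M * GG 2 3 M - 2 * GG 1 3 M - omega 1 3 M \<and>
         br (GG 2 3) (GG 1 3) M = GG 2 3 M * GG 1 3 M - 2 * GG 1 2 M - omega 1 2 M \<and>
         br (GG 1 3) (GG 1 2) M = GG 1 2 M * GG 1 3 M - 2 * GG 2 3 M - omega 2 3 M"
proof -
  define A B C where ABC: "A = M $ 1" "B = M $ 2" "C = M $ 3"
  have det: "det A = 1" "det B = 1" "det C = 1"
    using assms(3) by (simp_all add: ABC)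
  have rot: "trace (B ** C ** A) = trace (A ** B ** C)" "trace (C ** A ** B) = trace (A ** B ** C)"
    using trace_rotate(2)[of A B C] trace_rotate(2)[of C A B] by simp_all
  have sym: "trace (B ** A) = trace (A ** B)" "trace (C ** A) = trace (A ** C)"
    "trace (C ** B) = trace (B ** C)"
    by (rule trace_mul_sym)+
  show ?thesis
    \<comment> \<open>In the first bracket both trace identities contribute a tr(A C), hence the
      term -2 \<open>GG 1 3 M\<close>; the remaining tr(A) tr(C) + tr(B) tr(A B C) is
      \<open>omega 1 3 M\<close>, its signs cancelling in pairs. The other two are
      analogous.\<close>
    unfolding KS_GG_words[OF assms(1)] omega_eq
    unfolding GG_def G_def G_inf_def ABC[symmetric]
      trace_mult_square trace_mult_sandwich det rot
    by (simp add: sym algebra_simps)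
qed

end
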